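(* Let $\{K_t\}_{t>0}$ be one of the following families of kernels on $\mathbb{R}^n$: (1) the Poisson kernels $K_t(x)=P_t(x)=c_n\dfrac{t}{(t^2+|x|^2)^{(n+1)/2}}$; (2) the Caffarelli–Silvestre extension kernels $K_t(x)=P_t^{(s)}(x)=c_{n,s}\dfrac{t^{2s}}{(t^2+|x|^2)^{(n+2s)/2}}$, where $0<s<1$; (3) the Gaussian kernels $K_t(x)=G_t(x)=(4\pi t)^{-n/2}e^{-|x|^2/(4t)}$. Let $f\in L^1_{\mathrm{loc}}(\mathbb{R}^n)$ and let $x$ be a Lebesgue point of $f$ at which $$\lim_{t\to0^+}K_t*f(x)=f(x)\qquad\text{and}\qquad\sup_{t>0}|K_t*f(x)|<\infty .$$ Then for every $\gamma\in\mathbb{R}\setminus\{0\}$ and $q\in(0,\infty)$, $$|f(x)|=\gamma^{1/q}\lim_{\lambda\to\infty}\lambda\,w_\gamma\left(\left\{t>0:|K_t*f(x)|>\lambda t^{\gamma/q}\right\}\right)^{1/q}\quad\text{if }\gamma>0,$$ $$|f(x)|=(-\gamma)^{1/q}\lim_{\lambda\to0^+}\lambda\,w_\gamma\left(\left\{t>0:|K_t*f(x)|>\lambda t^{\gamma/q}\right\}\right)^{1/q}\quad\text{if }\gamma<0,$$ and there is a constant $C_K$ depending only on the kernel family such that $$|f(x)|\le|\gamma|^{1/q}\sup_{\lambda>0}\lambda\,w_\gamma\left(\left\{t>0:|K_t*f(x)|>\lambda t^{\gamma/q}\right\}\right)^{1/q}\le C_KMf(x).$$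
   Context: For $\gamma\ne0$ and measurable $E\subset(0,\infty)$, $w_\gamma(E):=\int_Et^{\gamma-1}\,dt$. $Mf(x):=\sup_{r>0}\frac{1}{|B(x,r)|}\int_{B(x,r)}|f(y)|\,dy$ is the centered Hardy–Littlewood maximal function (possibly $+\infty$). The constants $c_n,c_{n,s}>0$ are the normalizing constants, chosen so that $\int_{\mathbb{R}^n}P_t(x)\,dx=1$ and $\int_{\mathbb{R}^n}P^{(s)}_t(x)\,dx=1$. *)

theory Defs
  imports "HOL-Analysis.Analysis"
begin

section \<open>Kernels\<close>

text \<open>The constant \<open>c\<close> for which \<open>c * k t\<close> has integral 1 for every \<open>t > 0\<close>. It exists and is
  unique for the two families below: for each of them \<open>LINT x. k t x\<close> is finite, positive
  and, by scaling, independent of \<open>t\<close>.\<close>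

definition normalizing_const :: "(real \<Rightarrow> real ^ 'n \<Rightarrow> real) \<Rightarrow> real" where
  "normalizing_const k = (THE c. \<forall>t>0. (LINT x|lebesgue. c * k t x) = 1)"

definition poisson_kernel :: "real \<Rightarrow> real ^ 'n \<Rightarrow> real" where
  "poisson_kernel =
    (let k = (\<lambda>t (x :: real ^ 'n). t / (t\<^sup>2 + (norm x)\<^sup>2) powr ((real CARD('n) + 1) / 2))
     in (\<lambda>t x. normalizing_const k * k t x))"

definition caffarelli_silvestre_kernel :: "real \<Rightarrow> real \<Rightarrow> real ^ 'n \<Rightarrow> real" where
  "caffarelli_silvestre_kernel s =
    (let k = (\<lambda>t (x :: real ^ 'n).
           t powr (2 * s) / (t\<^sup>2 + (norm x)\<^sup>2) powr ((real CARD('n) + 2 * s) / 2))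
     in (\<lambda>t x. normalizing_const k * k t x))"

definition gauss_kernel :: "real \<Rightarrow> real ^ 'n \<Rightarrow> real" where
  "gauss_kernel t x =
    (4 * pi * t) powr (- (real CARD('n) / 2)) * exp (- ((norm x)\<^sup>2 / (4 * t)))"


section \<open>Convolution, Lebesgue points and the maximal function\<close>

definition locally_integrable :: "(real ^ 'n \<Rightarrow> complex) \<Rightarrow> bool" where
  "locally_integrable f \<longleftrightarrow> (\<forall>S. compact S \<longrightarrow> f absolutely_integrable_on S)"

text \<open>A non-integrable integrand gives \<open>convol k f x = 0\<close>, so \<open>convol_exists\<close> has to be
  required wherever the value \<open>(k * f)(x)\<close> is meant to be defined.\<close>

definition convol_exists :: "(real ^ 'n \<Rightarrow> real) \<Rightarrow> (real ^ 'n \<Rightarrow> complex) \<Rightarrow> real ^ 'n \<Rightarrow> bool" where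
  "convol_exists k f x \<longleftrightarrow> integrable lebesgue (\<lambda>y. k (x - y) *\<^sub>R f y)"

definition convol :: "(real ^ 'n \<Rightarrow> real) \<Rightarrow> (real ^ 'n \<Rightarrow> complex) \<Rightarrow> real ^ 'n \<Rightarrow> complex" where
  "convol k f x = (LINT y|lebesgue. k (x - y) *\<^sub>R f y)"

definition lebesgue_point :: "(real ^ 'n \<Rightarrow> complex) \<Rightarrow> real ^ 'n \<Rightarrow> bool" where
  "lebesgue_point f x \<longleftrightarrow>
    ((\<lambda>r. (LINT y:ball x r|lebesgue. norm (f y - f x)) / measure lebesgue (ball x r))
      \<longlongrightarrow> 0) (at_right 0)"

definition maximal_function :: "(real ^ 'n \<Rightarrow> complex) \<Rightarrow> real ^ 'n \<Rightarrow> ennreal" where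
  "maximal_function f x =
    (SUP r\<in>{0<..}. (\<integral>\<^sup>+y\<in>ball x r. ennreal (norm (f y)) \<partial>lebesgue) / emeasure lebesgue (ball x r))"


section \<open>Weighted weak-type quantities\<close>

definition weight :: "real \<Rightarrow> real set \<Rightarrow> ennreal" where
  "weight \<gamma> E = (\<integral>\<^sup>+t\<in>E. ennreal (t powr (\<gamma> - 1)) \<partial>lebesgue)"

text \<open>Real powers of extended nonnegative reals, meant for exponents \<open>p > 0\<close>.\<close>

definition enn_powr :: "ennreal \<Rightarrow> real \<Rightarrow> ennreal" where
  "enn_powr a p = (if a = \<infinity> then \<infinity> else ennreal (enn2real a powr p))"

text \<open>\<open>u\<close> stands for the function \<open>t \<mapsto> (K\<^sub>t * f)(x)\<close> with \<open>x\<close> fixed.\<close>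

definition weak_quantity :: "real \<Rightarrow> real \<Rightarrow> (real \<Rightarrow> complex) \<Rightarrow> real \<Rightarrow> ennreal" where
  "weak_quantity \<gamma> q u l =
    ennreal l * enn_powr (weight \<gamma> {t. t > 0 \<and> norm (u t) > l * t powr (\<gamma> / q)}) (1 / q)"

end

theory Submission
  imports Defs
begin

text \<open>The set where \<open>c > \<lambda> * t powr (\<gamma> / q)\<close> has weight \<open>(c / \<lambda>) powr q / \<bar>\<gamma>\<bar>\<close>, whatever the sign of
  \<open>\<gamma>\<close>, so a function \<open>u\<close> that is constantly \<open>c\<close> gives a weak quantity independent of \<open>\<lambda>\<close>. In the
  limit in question the sets concentrate, in weight, near \<open>t = 0\<close>, where \<open>norm (u t)\<close> is squeezed
  around \<open>norm (f x)\<close>; this gives the two limits, and hence the lower bound for the supremum.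
  The upper bound is the same weight computation with \<open>c\<close> a bound for \<open>norm (u t)\<close>, and such a
  bound is a multiple of the maximal function, because each kernel is dominated by a dyadic
  sum of normalised indicators of balls.\<close>

section \<open>Weights of intervals and of sublevel sets of powers\<close>

lemma weight_mono: "E \<subseteq> F \<Longrightarrow> weight \<gamma> E \<le> weight \<gamma> F"
  unfolding weight_def by (intro nn_integral_mono) (auto split: split_indicator)

text \<open>Additivity of the nonnegative integral asks for measurable integrands, hence the
  measurable covering sets. The superlevel sets of \<open>u\<close>, about whose measurability
  nothing is assumed, are therefore compared with other sets through \<open>weight_mono\<close>
  only.\<close>

lemma weight_Un_le:
  assumes "F \<in> sets lebesgue" "G \<in> sets lebesgue" "E \<subseteq> F \<union> G"
  shows "weight \<gamma> E \<le> weight \<gamma> F + weight \<gamma> G"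
proof -
  have "(\<lambda>t::real. t powr (\<gamma> - 1)) \<in> borel_measurable lborel"
    by measurable
  note [measurable] = measurable_completion[OF this] assms(1,2)
  have "weight \<gamma> E \<le> (\<integral>\<^sup>+t. ennreal (t powr (\<gamma> - 1)) * indicator F t
      + ennreal (t powr (\<gamma> - 1)) * indicator G t \<partial>lebesgue)"
    unfolding weight_def using assms(3)
    by (intro nn_integral_mono) (auto split: split_indicator)
  also have "\<dots> = weight \<gamma> F + weight \<gamma> G"
    unfolding weight_def by (intro nn_integral_add) measurable
  finally show ?thesis .
qed

lemma weight_has_integral:
  assumes "((\<lambda>t. t powr (\<gamma> - 1)) has_integral I) E"
  shows "weight \<gamma> E = ennreal I"
  unfolding weight_def nn_integral_completion
  by (rule nn_integral_has_integral_lebesgue'[OF _ assms]) simp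

lemma weight_atLeast:
  assumes "\<gamma> < 0" "S > 0"
  shows "weight \<gamma> {S..} = ennreal (S powr \<gamma> / \<bar>\<gamma>\<bar>)"
  using weight_has_integral[OF has_integral_powr_to_inf[of "\<gamma> - 1" S]] assms by simp

lemma weight_greaterThanAtMost:
  assumes "\<gamma> > 0" "T > 0"
  shows "weight \<gamma> {0<..T} = ennreal (T powr \<gamma> / \<bar>\<gamma>\<bar>)"
proof -
  \<comment> \<open>The integrands agree at t = 0 too, because \<open>0 powr (\<gamma> - 1)\<close>
    is 0.\<close>
  have "weight \<gamma> {0<..T} = weight \<gamma> {0..T}"
    unfolding weight_def by (intro nn_integral_cong) (auto split: split_indicator)
  then show ?thesis
    using weight_has_integral[OF has_integral_powr_from_0[of "\<gamma> - 1" T]] assms by simp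
qed

text \<open>Logarithms make the condition linear in \<open>ln t\<close>; dividing by
  \<open>p\<close> keeps or reverses it according to the sign of \<open>p\<close>, which decides
  between an initial interval and a tail.\<close>

lemma powr_sublevel:
  fixes p c :: real
  assumes "p \<noteq> 0" "c > 0"
  shows "{t. t > 0 \<and> t powr p \<le> c} =
    (if p > 0 then {0<..c powr (1 / p)} else {c powr (1 / p)..})"
proof -
  have *: "t powr p \<le> c \<longleftrightarrow> (if p > 0 then t \<le> c powr (1 / p) else c powr (1 / p) \<le> t)"
    if "t > 0" for t
  proof -
    have "t powr p \<le> c \<longleftrightarrow> p * ln t \<le> ln c"
      using that assms by (subst ln_le_cancel_iff[symmetric]) (auto simp: ln_powr)
    moreover have "t \<le> c powr (1 / p) \<longleftrightarrow> ln t \<le> ln c / p"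
      using that assms by (subst ln_le_cancel_iff[symmetric]) (auto simp: ln_powr)
    moreover have "c powr (1 / p) \<le> t \<longleftrightarrow> ln c / p \<le> ln t"
      using that assms by (subst ln_le_cancel_iff[symmetric]) (auto simp: ln_powr)
    ultimately show ?thesis
      using assms by (auto simp: field_simps)
  qed
  have "t > 0" if "c powr (1 / p) \<le> t" for t
    using that assms by (smt (verit) powr_gt_zero)
  then show ?thesis
    using * by (auto split: if_splits)
qed

lemma sets_powr_sublevel: "{t. t > 0 \<and> t powr p \<le> (c::real)} \<in> sets lebesgue"
  by (intro sets_completionI_sets) simp

lemma weight_powr_sublevel:
  assumes "\<gamma> \<noteq> 0" "q > 0" "c \<ge> 0"
  shows "weight \<gamma> {t. t > 0 \<and> t powr (\<gamma> / q) \<le> c} = ennreal (c powr q / \<bar>\<gamma>\<bar>)"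
proof (cases "c = 0")
  case True
  \<comment> \<open>The formula survives in this case because \<open>0 powr q\<close> is 0.\<close>
  then have "{t. t > 0 \<and> t powr (\<gamma> / q) \<le> c} = {}"
    by (auto simp: not_le)
  with True show ?thesis
    by (simp add: weight_def)
next
  case False
  with assms have "c > 0" by simp
  have "\<gamma> / q \<noteq> 0" using assms by simp
  note eq = powr_sublevel[OF this \<open>c > 0\<close>]
  \<comment> \<open>Raising the endpoint to the power \<gamma> removes \<gamma> from the exponent,
    so the initial interval and the tail give the same value.\<close>
  have "(c powr (q / \<gamma>)) powr \<gamma> = c powr q"
    using assms by (simp add: powr_powr)
  then show ?thesis
    using assms \<open>c > 0\<close> weight_atLeast[of \<gamma> "c powr (q / \<gamma>)"]
      weight_greaterThanAtMost[of \<gamma> "c powr (q / \<gamma>)"]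
    unfolding eq by (auto simp: zero_less_divide_iff)
qed

lemma enn_powr_ennreal: "x \<ge> 0 \<Longrightarrow> enn_powr (ennreal x) p = ennreal (x powr p)"
  by (simp add: enn_powr_def)

lemma enn_powr_mono:
  assumes "a \<le> b" "p > 0"
  shows "enn_powr a p \<le> enn_powr b p"
proof (cases "b = \<infinity>")
  case False
  then have "a \<noteq> \<infinity>" using assms(1) by (auto simp: top_unique)
  then show ?thesis
    using False assms
    by (auto simp: enn_powr_def top.not_eq_extremum intro!: ennreal_leI powr_mono2 enn2real_mono)
qed (simp add: enn_powr_def)

section \<open>Weak quantities of a bounded function with a limit at 0\<close>

text \<open>With x fixed, kernel and convolution disappear: both limits and the lower bound for the
  supremum follow from the limit of \<open>u\<close> at 0 and its boundedness.\<close>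

locale bounded_orbit =
  fixes u :: "real \<Rightarrow> complex" and z :: complex and \<gamma> q :: real
  assumes lim: "(u \<longlongrightarrow> z) (at_right 0)"
    and bdd: "bdd_above ((\<lambda>t. norm (u t)) ` {0<..})"
    and nz: "\<gamma> \<noteq> 0" and q: "q > 0"
begin

definition E :: "real \<Rightarrow> real set" where
  "E l = {t. t > 0 \<and> norm (u t) > l * t powr (\<gamma> / q)}"

text \<open>\<open>enn2real\<close> would send an infinite weight to 0; \<open>weight_E\<close>
  excludes this for \<open>l > 0\<close>, so limits can be computed in the reals.\<close>

definition W :: "real \<Rightarrow> real" where
  "W l = enn2real (weight \<gamma> (E l))"

text \<open>One filter for both signs, so that each estimate is stated once. Along it, t away from 0
  is negligible: for \<gamma> > 0 and large \<open>l\<close> no such t lies in \<open>E l\<close>,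
  and for \<gamma> < 0 the far part has bounded weight, which the factor \<open>l powr q\<close>
  sends to 0.\<close>

definition F :: "real filter" where
  "F = (if \<gamma> > 0 then at_top else at_right 0)"

lemma weight_E_le:
  assumes "\<And>t. t > 0 \<Longrightarrow> norm (u t) \<le> B" "l > 0"
  shows "weight \<gamma> (E l) \<le> ennreal ((B / l) powr q / \<bar>\<gamma>\<bar>)"
proof -
  have "0 \<le> B" using assms(1)[of 1] norm_ge_zero[of "u 1"] by linarith
  have "E l \<subseteq> {t. t > 0 \<and> t powr (\<gamma> / q) \<le> B / l}"
    using assms by (force simp: E_def field_simps)
  then have "weight \<gamma> (E l) \<le> weight \<gamma> {t. t > 0 \<and> t powr (\<gamma> / q) \<le> B / l}"
    by (rule weight_mono)
  also have "\<dots> = ennreal ((B / l) powr q / \<bar>\<gamma>\<bar>)"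
    using nz q assms \<open>0 \<le> B\<close> by (intro weight_powr_sublevel) auto
  finally show ?thesis .
qed

text \<open>The factor \<open>l\<close> cancels the 1/\<open>l\<close> in the weight bound, so the
  estimate is uniform in \<open>l\<close> and passes to the supremum.\<close>

lemma weak_quantity_le:
  assumes "\<And>t. t > 0 \<Longrightarrow> norm (u t) \<le> B" "l > 0"
  shows "ennreal (\<bar>\<gamma>\<bar> powr (1 / q)) * weak_quantity \<gamma> q u l \<le> ennreal B"
proof -
  have B: "0 \<le> B" using assms(1)[of 1] norm_ge_zero[of "u 1"] by linarith
  have "enn_powr (weight \<gamma> (E l)) (1 / q) \<le> enn_powr (ennreal ((B / l) powr q / \<bar>\<gamma>\<bar>)) (1 / q)"
    using q weight_E_le[OF assms] by (intro enn_powr_mono) auto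
  also have "\<dots> = ennreal (((B / l) powr q / \<bar>\<gamma>\<bar>) powr (1 / q))"
    by (simp add: enn_powr_ennreal)
  also have "((B / l) powr q / \<bar>\<gamma>\<bar>) powr (1 / q) = (B / l) / \<bar>\<gamma>\<bar> powr (1 / q)"
    using B assms q nz by (simp add: powr_divide powr_mult powr_powr)
  finally have "weak_quantity \<gamma> q u l \<le> ennreal l * ennreal ((B / l) / \<bar>\<gamma>\<bar> powr (1 / q))"
    unfolding weak_quantity_def E_def by (intro mult_left_mono) auto
  also have "\<dots> = ennreal (B / \<bar>\<gamma>\<bar> powr (1 / q))"
    using assms B by (simp flip: ennreal_mult)
  finally have "ennreal (\<bar>\<gamma>\<bar> powr (1 / q)) * weak_quantity \<gamma> q u l
      \<le> ennreal (\<bar>\<gamma>\<bar> powr (1 / q)) * ennreal (B / \<bar>\<gamma>\<bar> powr (1 / q))"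
    by (rule mult_left_mono) simp
  also have "\<dots> = ennreal B"
    using nz B by (simp flip: ennreal_mult)
  finally show ?thesis .
qed

lemma eventually_pos: "eventually (\<lambda>l. l > 0) F"
  by (auto simp: F_def eventually_gt_at_top eventually_at_right_less)

lemma weight_E:
  assumes "l > 0"
  shows "weight \<gamma> (E l) = ennreal (W l)"
proof -
  obtain B where "\<And>t. t > 0 \<Longrightarrow> norm (u t) \<le> B"
    using bdd by (auto simp: bdd_above_def)
  from weight_E_le[OF this assms] have "weight \<gamma> (E l) < top"
    by (meson ennreal_less_top order_le_less_trans)
  then show ?thesis
    by (simp add: W_def)
qed

text \<open>Near 0 the values of \<open>u\<close> stay below \<open>c\<close>, so there
  \<open>E l\<close> lies in the sublevel set for \<open>c / l\<close>; along \<open>F\<close> the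
  points far from 0 cause no exception.\<close>

lemma eventually_le:
  assumes "norm z < c"
  shows "eventually (\<lambda>l. l powr q * W l \<le> c powr q / \<bar>\<gamma>\<bar>) F"
proof -
  have "c > 0" using assms norm_ge_zero[of z] by linarith
  have "eventually (\<lambda>t. norm (u t) < c) (at_right 0)"
    using tendsto_norm[OF lim] assms by (rule order_tendstoD)
  then obtain d where d: "d > 0" "\<And>t. 0 < t \<Longrightarrow> t < d \<Longrightarrow> norm (u t) < c"
    by (auto simp: eventually_at_right_field)
  obtain B where B: "\<And>t. t > 0 \<Longrightarrow> norm (u t) \<le> B"
    using bdd by (auto simp: bdd_above_def)
  \<comment> \<open>The implication covers both signs: its premise fails for large \<open>l\<close>
    if \<gamma> > 0, and its conclusion holds for small \<open>l\<close> if \<gamma> < 0.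
    Monotonicity of the power reduces both claims to t = \<open>d\<close>.\<close>
  have far: "eventually (\<lambda>l. \<forall>t\<ge>d. norm (u t) > l * t powr (\<gamma> / q) \<longrightarrow> l * t powr (\<gamma> / q) \<le> c) F"
  proof (cases "\<gamma> > 0")
    case True
    have large: "l * t powr (\<gamma> / q) \<ge> norm (u t)"
      if l: "l > 0" "l \<ge> B / d powr (\<gamma> / q)" and t: "t \<ge> d" for l t
    proof -
      have "norm (u t) \<le> B" using B t d by simp
      also have "\<dots> \<le> l * d powr (\<gamma> / q)" using l d by (simp add: field_simps)
      also have "\<dots> \<le> l * t powr (\<gamma> / q)"
        using l t d True q by (intro mult_left_mono powr_mono2) auto
      finally show ?thesis .
    qed
    have "eventually (\<lambda>l. \<forall>t\<ge>d. l * t powr (\<gamma> / q) \<ge> norm (u t)) at_top"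
      using eventually_gt_at_top[of 0] eventually_ge_at_top[of "B / d powr (\<gamma> / q)"]
      by eventually_elim (use large in blast)
    then show ?thesis
      using True by (auto simp: F_def not_less elim!: eventually_mono)
  next
    case False
    have "l * t powr (\<gamma> / q) \<le> c"
      if l: "l > 0" "l < c / d powr (\<gamma> / q)" and t: "t \<ge> d" for l t
    proof -
      have "l * t powr (\<gamma> / q) \<le> l * d powr (\<gamma> / q)"
        using l t d False nz q by (intro mult_left_mono powr_mono2') (auto simp: divide_nonpos_pos)
      also have "\<dots> \<le> c" using l d by (simp add: field_simps)
      finally show ?thesis .
    qed
    moreover have "eventually (\<lambda>l. 0 < l \<and> l < c / d powr (\<gamma> / q)) (at_right 0)"
      using \<open>c > 0\<close> d by (auto simp: eventually_at_right_field intro!: exI[of _ "c / d powr (\<gamma> / q)"])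
    ultimately show ?thesis
      using False by (auto simp: F_def elim!: eventually_mono)
  qed
  from far eventually_pos show ?thesis
  proof eventually_elim
    case (elim l)
    have "E l \<subseteq> {t. t > 0 \<and> t powr (\<gamma> / q) \<le> c / l}"
    proof
      fix t assume t: "t \<in> E l"
      have "l * t powr (\<gamma> / q) \<le> c"
      proof (cases "t < d")
        case True
        then show ?thesis using d(2)[of t] t by (simp add: E_def)
      next
        case False
        then show ?thesis using elim t by (auto simp: E_def)
      qed
      then show "t \<in> {t. t > 0 \<and> t powr (\<gamma> / q) \<le> c / l}"
        using t elim by (simp add: E_def field_simps)
    qed
    from weight_mono[OF this, of \<gamma>] have "ennreal (W l) \<le> ennreal ((c / l) powr q / \<bar>\<gamma>\<bar>)"
      using weight_powr_sublevel[OF nz q, of "c / l"] weight_E[of l] \<open>c > 0\<close> elim by simp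
    then have "W l \<le> (c / l) powr q / \<bar>\<gamma>\<bar>"
      by (subst (asm) ennreal_le_iff) auto
    then have "l powr q * W l \<le> l powr q * ((c / l) powr q / \<bar>\<gamma>\<bar>)"
      by (rule mult_left_mono) simp
    also have "\<dots> = c powr q / \<bar>\<gamma>\<bar>"
      using elim \<open>c > 0\<close> by (simp add: powr_divide)
    finally show ?case .
  qed
qed

text \<open>Near 0 the values of \<open>u\<close> exceed \<open>c\<close>, so \<open>E l\<close>
  contains the part below \<open>d\<close> of the sublevel set for \<open>c / l\<close>. The part
  beyond \<open>d\<close> is an error, absorbed by \<open>e\<close> after multiplication by
  \<open>l powr q\<close>.\<close>

lemma eventually_ge:
  assumes "0 < c" "c < norm z" "e > 0"
  shows "eventually (\<lambda>l. c powr q / \<bar>\<gamma>\<bar> - e \<le> l powr q * W l) F"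
proof -
  have "eventually (\<lambda>t. norm (u t) > c) (at_right 0)"
    using tendsto_norm[OF lim] assms(2) by (rule order_tendstoD)
  then obtain d where d: "d > 0" "\<And>t. 0 < t \<Longrightarrow> t < d \<Longrightarrow> norm (u t) > c"
    by (auto simp: eventually_at_right_field)
  define G where "G l = {t. t > 0 \<and> t powr (\<gamma> / q) \<le> c / l} \<inter> {d..}" for l
  \<comment> \<open>\<open>D\<close> is a bound for the error weight independent of
    \<open>l\<close>: 0 if \<gamma> > 0, as \<open>G l\<close> is eventually empty, and the weight
    of the whole tail \<open>{d..}\<close> if \<gamma> < 0.\<close>
  have far: "\<exists>D\<ge>0. eventually (\<lambda>l. weight \<gamma> (G l) \<le> ennreal D) F \<and> ((\<lambda>l. l powr q * D) \<longlongrightarrow> 0) F"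
  proof (cases "\<gamma> > 0")
    case True
    have large: "G l = {}" if l: "l > 0" "l > c / d powr (\<gamma> / q)" for l
    proof -
      have "\<not> t powr (\<gamma> / q) \<le> c / l" if "t \<ge> d" for t
      proof -
        have "c / l < d powr (\<gamma> / q)" using l d by (simp add: field_simps)
        also have "\<dots> \<le> t powr (\<gamma> / q)"
          using that d True q by (intro powr_mono2) auto
        finally show ?thesis by simp
      qed
      then show ?thesis by (auto simp: G_def)
    qed
    have "eventually (\<lambda>l. G l = {}) at_top"
      using eventually_gt_at_top[of 0] eventually_gt_at_top[of "c / d powr (\<gamma> / q)"]
      by eventually_elim (use large in blast)
    then have "eventually (\<lambda>l. weight \<gamma> (G l) \<le> ennreal 0) at_top"
      by eventually_elim (simp add: weight_def)
    with True show ?thesis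
      by (intro exI[of _ 0]) (simp add: F_def)
  next
    case False
    have "weight \<gamma> (G l) \<le> ennreal (d powr \<gamma> / \<bar>\<gamma>\<bar>)" for l
      using weight_mono[of "G l" "{d..}" \<gamma>] weight_atLeast[of \<gamma> d] False nz d
      by (auto simp: G_def)
    moreover have "((\<lambda>l. l powr q * (d powr \<gamma> / \<bar>\<gamma>\<bar>)) \<longlongrightarrow> 0 powr q * (d powr \<gamma> / \<bar>\<gamma>\<bar>)) (at_right 0)"
      using q by (intro tendsto_intros tendsto_powr2)
        (auto intro!: eventually_at_rightI[of 0 1])
    ultimately show ?thesis
      using False by (intro exI[of _ "d powr \<gamma> / \<bar>\<gamma>\<bar>"]) (auto simp: F_def not_less divide_nonneg_nonpos)
  qed
  then obtain D where D: "D \<ge> 0" "eventually (\<lambda>l. weight \<gamma> (G l) \<le> ennreal D) F"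
    "((\<lambda>l. l powr q * D) \<longlongrightarrow> 0) F" by blast
  from D(2) order_tendstoD(2)[OF D(3) \<open>e > 0\<close>] eventually_pos show ?thesis
  proof eventually_elim
    case (elim l)
    let ?S = "{t. t > 0 \<and> t powr (\<gamma> / q) \<le> c / l}"
    have W0: "W l \<ge> 0" by (simp add: W_def)
    have near: "?S \<inter> {..<d} \<subseteq> E l"
      using elim d(2) by (force simp: E_def field_simps)
    have "?S \<in> sets lebesgue" by (rule sets_powr_sublevel)
    then have "weight \<gamma> ?S \<le> weight \<gamma> (?S \<inter> {..<d}) + weight \<gamma> (G l)"
      unfolding G_def by (intro weight_Un_le) auto
    also have "\<dots> \<le> ennreal (W l) + ennreal D"
      using weight_mono[OF near, of \<gamma>] elim weight_E by (intro add_mono) auto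
    also have "\<dots> = ennreal (W l + D)"
      using W0 D(1) by simp
    finally have "(c / l) powr q / \<bar>\<gamma>\<bar> \<le> W l + D"
      using weight_powr_sublevel[OF nz q, of "c / l"] assms elim W0 D(1)
      by (simp add: ennreal_le_iff del: ennreal_plus)
    then have "l powr q * ((c / l) powr q / \<bar>\<gamma>\<bar>) \<le> l powr q * (W l + D)"
      by (rule mult_left_mono) simp
    moreover have "l powr q * ((c / l) powr q / \<bar>\<gamma>\<bar>) = c powr q / \<bar>\<gamma>\<bar>"
      using elim assms by (simp add: powr_divide)
    ultimately show ?case
      using elim unfolding distrib_left by linarith
  qed
qed

lemma tendsto_powr_W: "((\<lambda>l. l powr q * W l) \<longlongrightarrow> norm z powr q / \<bar>\<gamma>\<bar>) F"
proof (rule order_tendstoI)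
  fix y assume "norm z powr q / \<bar>\<gamma>\<bar> < y"
  then obtain y' where y': "norm z powr q / \<bar>\<gamma>\<bar> < y'" "y' < y"
    using dense by blast
  \<comment> \<open>The level c is the one with \<open>c powr q / \<bar>\<gamma>\<bar> = y'\<close>.
    The gap between \<open>y'\<close> and \<open>y\<close> makes the weak bound of
    \<open>eventually_le\<close> strict.\<close>
  have "norm z powr q < y' * \<bar>\<gamma>\<bar>"
    using y'(1) nz by (simp add: field_simps)
  then have "(norm z powr q) powr (1 / q) < (y' * \<bar>\<gamma>\<bar>) powr (1 / q)"
    using q by (intro powr_less_mono2) auto
  then have "norm z < (y' * \<bar>\<gamma>\<bar>) powr (1 / q)"
    using q by (simp add: powr_powr)
  note eventually_le[OF this]
  moreover have "y' > 0"
    using y'(1) by (smt (verit) divide_nonneg_nonneg powr_ge_zero abs_ge_zero)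
  ultimately show "eventually (\<lambda>l. l powr q * W l < y) F"
    using q nz y'(2) by (simp add: powr_powr) (erule eventually_mono, simp)
next
  fix y assume y: "y < norm z powr q / \<bar>\<gamma>\<bar>"
  show "eventually (\<lambda>l. y < l powr q * W l) F"
  \<comment> \<open>Negative \<open>y\<close> is settled by nonnegativity of \<open>W\<close>;
    otherwise \<open>y1\<close> is positive and has a root to serve as level.\<close>
  proof (cases "y < 0")
    case True
    show ?thesis
      by (rule always_eventually) (use True in \<open>auto simp: W_def intro: less_le_trans\<close>)
  next
    case False
    obtain y1 where y1: "y < y1" "y1 < norm z powr q / \<bar>\<gamma>\<bar>"
      using dense[OF y] by blast
    have "(y1 * \<bar>\<gamma>\<bar>) powr (1 / q) < (norm z powr q) powr (1 / q)"
      using q y1 nz False by (intro powr_less_mono2) (auto simp: field_simps)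
    then have "(y1 * \<bar>\<gamma>\<bar>) powr (1 / q) < norm z"
      using q by (simp add: powr_powr)
    moreover have "0 < (y1 * \<bar>\<gamma>\<bar>) powr (1 / q)"
      using y1 False nz by simp
    \<comment> \<open>With error (\<open>y1\<close> - \<open>y\<close>) / 2 the lower bound is the
      midpoint of \<open>y\<close> and \<open>y1\<close>, still above \<open>y\<close>.\<close>
    ultimately have "eventually (\<lambda>l. ((y1 * \<bar>\<gamma>\<bar>) powr (1 / q)) powr q / \<bar>\<gamma>\<bar> - (y1 - y) / 2 \<le> l powr q * W l) F"
      using y1 by (intro eventually_ge) auto
    then show ?thesis
    proof eventually_elim
      case (elim l)
      have "((y1 * \<bar>\<gamma>\<bar>) powr (1 / q)) powr q / \<bar>\<gamma>\<bar> = y1"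
        using q nz y1 False by (simp add: powr_powr)
      from elim[unfolded this] y1(1) show ?case by (simp add: field_simps)
    qed
  qed
qed

lemma weak_quantity_eq:
  assumes "l > 0"
  shows "weak_quantity \<gamma> q u l = ennreal ((l powr q * W l) powr (1 / q))"
proof -
  have W0: "W l \<ge> 0" by (simp add: W_def)
  have "weak_quantity \<gamma> q u l = ennreal l * enn_powr (ennreal (W l)) (1 / q)"
    using weight_E[OF assms] by (simp add: weak_quantity_def E_def)
  also have "\<dots> = ennreal (l * W l powr (1 / q))"
    using W0 assms by (simp add: enn_powr_ennreal ennreal_mult)
  also have "l * W l powr (1 / q) = (l powr q * W l) powr (1 / q)"
    using W0 assms q by (simp add: powr_mult powr_powr)
  finally show ?thesis .
qed

lemma weak_quantity_tendsto:
  "(weak_quantity \<gamma> q u \<longlongrightarrow> ennreal (norm z / \<bar>\<gamma>\<bar> powr (1 / q))) F"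
proof -
  \<comment> \<open>The base may tend to 0, when \<open>z\<close> = 0; \<open>tendsto_powr2\<close>
    allows this for a nonnegative base and a positive limit exponent.\<close>
  have "((\<lambda>l. ennreal ((l powr q * W l) powr (1 / q)))
      \<longlongrightarrow> ennreal ((norm z powr q / \<bar>\<gamma>\<bar>) powr (1 / q))) F"
    using q by (intro tendsto_ennrealI tendsto_powr2 tendsto_powr_W tendsto_const)
      (auto simp: W_def)
  also have "(norm z powr q / \<bar>\<gamma>\<bar>) powr (1 / q) = norm z / \<bar>\<gamma>\<bar> powr (1 / q)"
    using q by (simp add: powr_divide powr_powr)
  finally show ?thesis
    by (rule Lim_transform_eventually)
      (use eventually_pos in eventually_elim, simp add: weak_quantity_eq)
qed

lemma norm_eq:
  "ennreal (norm z) = ennreal (\<bar>\<gamma>\<bar> powr (1 / q)) * ennreal (norm z / \<bar>\<gamma>\<bar> powr (1 / q))"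
  using nz by (simp flip: ennreal_mult)

text \<open>\<open>F\<close> is a proper filter living on \<open>l > 0\<close>, so the limit along
  it cannot exceed the supremum.\<close>

lemma norm_le_SUP:
  "ennreal (norm z) \<le> ennreal (\<bar>\<gamma>\<bar> powr (1 / q)) * (SUP l\<in>{0<..}. weak_quantity \<gamma> q u l)"
  unfolding norm_eq
proof (rule mult_left_mono)
  have "F \<noteq> bot" by (simp add: F_def)
  show "ennreal (norm z / \<bar>\<gamma>\<bar> powr (1 / q)) \<le> (SUP l\<in>{0<..}. weak_quantity \<gamma> q u l)"
    by (rule tendsto_upperbound[OF weak_quantity_tendsto _ \<open>F \<noteq> bot\<close>])
      (use eventually_pos in eventually_elim, auto intro: SUP_upper)
qed simp

end

section \<open>Domination of convolutions by the maximal function\<close>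

lemma integral_ball_le_maximal_function:
  fixes f :: "real ^ 'n \<Rightarrow> complex"
  assumes "r > 0"
  shows "(\<integral>\<^sup>+y\<in>ball x r. ennreal (norm (f y)) \<partial>lebesgue)
    \<le> ennreal (unit_ball_vol (real CARD('n)) * r ^ CARD('n)) * maximal_function f x"
proof -
  let ?I = "\<integral>\<^sup>+y\<in>ball x r. ennreal (norm (f y)) \<partial>lebesgue"
  let ?v = "ennreal (unit_ball_vol (real CARD('n)) * r ^ CARD('n))"
  have v: "emeasure lebesgue (ball x r) = ?v"
    using assms by (simp add: emeasure_ball)
  \<comment> \<open>Division in \<open>ennreal\<close> can be undone only when the volume is neither
    0 nor infinite.\<close>
  have "unit_ball_vol (real CARD('n)) * r ^ CARD('n) > 0"
    using assms by (intro mult_pos_pos unit_ball_vol_pos) auto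
  then have "?v \<noteq> 0" "?v \<noteq> top"
    by (simp_all only: ennreal_eq_0_iff not_le ennreal_neq_top not_False_eq_True)
  then have "?I = ?v * (?I / ?v)"
    using ennreal_mult_divide_eq[of ?v ?I]
    by (simp only: ennreal_times_divide mult.commute[of ?v] not_False_eq_True simp_thms)
  also have "\<dots> \<le> ?v * maximal_function f x"
    unfolding maximal_function_def using assms
    by (intro mult_left_mono SUP_upper2[of r]) (auto simp: v)
  finally show ?thesis .
qed

text \<open>Local integrability speaks of compact sets, so the open ball inherits it from the closed
  one. This measurability permits integrating the dyadic sum term by term.\<close>

lemma locally_integrable_measurable_ball:
  fixes f :: "real ^ 'n \<Rightarrow> complex"
  assumes "locally_integrable f"
  shows "(\<lambda>y. ennreal (norm (f y)) * indicator (ball x r) y) \<in> borel_measurable lebesgue"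
proof -
  have "f absolutely_integrable_on ball x r"
    using assms unfolding locally_integrable_def
    by (intro set_integrable_subset[of _ "cball x r" _ "ball x r"]) auto
  then have "(\<lambda>y. indicator (ball x r) y *\<^sub>R f y) \<in> borel_measurable lebesgue"
    unfolding set_integrable_def by (rule borel_measurable_integrable)
  then have "(\<lambda>y. ennreal (norm (indicator (ball x r) y *\<^sub>R f y))) \<in> borel_measurable lebesgue"
    by measurable
  also have "(\<lambda>y. ennreal (norm (indicator (ball x r) y *\<^sub>R f y)))
      = (\<lambda>y. ennreal (norm (f y)) * indicator (ball x r) y)"
    by (auto split: split_indicator)
  finally show ?thesis .
qed

text \<open>The \<open>j\<close>-th coefficient is comparable with \<open>2 powr (- \<alpha> * j)\<close> divided by the volume of
  the ball of radius \<open>2 ^ j * \<rho>\<close>, which is what makes the sum against the maximal function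
  converge.\<close>

lemma kernel_le_dyadic_sum:
  fixes \<rho> \<alpha> d m :: real
  assumes "\<rho> > 0" "d + \<alpha> > 0" "m \<ge> 0"
  shows "ennreal (\<rho> powr \<alpha> / (\<rho>\<^sup>2 + m\<^sup>2) powr ((d + \<alpha>) / 2))
    \<le> (\<Sum>j. ennreal (\<rho> powr \<alpha> / (2 ^ j * \<rho> / 2) powr (d + \<alpha>)) * (if m < 2 ^ j * \<rho> then 1 else 0))"
    (is "?k \<le> (\<Sum>j. ?a j * ?i j)")
proof -
  have "\<exists>j::nat. m < 2 ^ j * \<rho>"
    using real_arch_pow[of 2 "m / \<rho>"] assms by (auto simp: field_simps)
  \<comment> \<open>This one term already dominates: minimality gives
    \<open>m \<ge> 2 ^ (j - 1) * \<rho>\<close> for positive \<open>j\<close>, and for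
    \<open>j\<close> = 0 the summand \<open>\<rho>\<^sup>2\<close> suffices.\<close>
  define j where "j = (LEAST j::nat. m < 2 ^ j * \<rho>)"
  have j: "m < 2 ^ j * \<rho>"
    unfolding j_def using \<open>\<exists>j. _\<close> by (rule LeastI_ex)
  have "(2 ^ j * \<rho> / 2)\<^sup>2 \<le> \<rho>\<^sup>2 + m\<^sup>2"
  proof (cases j)
    case 0
    have "(\<rho> / 2)\<^sup>2 \<le> \<rho>\<^sup>2"
      using assms by (intro power_mono) auto
    with 0 show ?thesis by (simp add: add_increasing2)
  next
    case (Suc i)
    have "\<not> m < 2 ^ i * \<rho>"
      using Suc not_less_Least[of i "\<lambda>j. m < 2 ^ j * \<rho>"] by (simp add: j_def)
    then have "(2 ^ i * \<rho>)\<^sup>2 \<le> m\<^sup>2"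
      using assms by (intro power_mono) auto
    with Suc show ?thesis by (simp add: add_increasing)
  qed
  then have "((2 ^ j * \<rho> / 2)\<^sup>2) powr ((d + \<alpha>) / 2) \<le> (\<rho>\<^sup>2 + m\<^sup>2) powr ((d + \<alpha>) / 2)"
    using assms by (intro powr_mono2) auto
  moreover have "((2 ^ j * \<rho> / 2)\<^sup>2) powr ((d + \<alpha>) / 2) = (2 ^ j * \<rho> / 2) powr (d + \<alpha>)"
    using assms by (simp add: powr_powr add_divide_distrib flip: powr_numeral)
  ultimately have "?k \<le> ?a j * ?i j"
    using assms j by (auto intro!: ennreal_leI divide_left_mono mult_pos_pos add_pos_nonneg)
  also have "\<dots> \<le> (\<Sum>j. ?a j * ?i j)"
    using sum_le_suminf[of "\<lambda>j. ?a j * ?i j" "{j}"] by simp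
  finally show ?thesis .
qed

text \<open>\<rho> is the length scale of the kernel and \<alpha> its decay beyond the dimension.
  Each dyadic ball costs at most its volume times the maximal function; the scale cancels, so the
  constant depends on neither t, x nor f.\<close>

lemma convol_le_maximal_function:
  fixes k :: "real \<Rightarrow> real ^ 'n \<Rightarrow> real" and \<rho> :: "real \<Rightarrow> real"
  assumes \<alpha>: "\<alpha> > 0" and \<rho>: "\<And>t. t > 0 \<Longrightarrow> \<rho> t > 0"
    and k: "\<And>t z. t > 0 \<Longrightarrow>
      \<bar>k t z\<bar> \<le> A * (\<rho> t powr \<alpha> / ((\<rho> t)\<^sup>2 + (norm z)\<^sup>2) powr ((real CARD('n) + \<alpha>) / 2))"
  shows "\<exists>C>0. \<forall>f x t. locally_integrable f \<longrightarrow> t > 0 \<longrightarrow>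
    ennreal (norm (convol (k t) f x)) \<le> ennreal C * maximal_function f x"
proof -
  define d where "d = real CARD('n)"
  define v where "v = unit_ball_vol d"
  have d: "d > 0" by (simp add: d_def)
  have v: "v > 0" unfolding v_def using d by (intro unit_ball_vol_pos) simp
  define S where "S = (\<Sum>j. v * 2 powr (d + \<alpha>) * (2 powr (-\<alpha>)) ^ j)"
  have "2 powr (- \<alpha>) < (1::real)" using \<alpha> by (simp add: powr_less_one)
  then have summ: "summable (\<lambda>j. v * 2 powr (d + \<alpha>) * (2 powr (-\<alpha>)) ^ j)"
    by (intro summable_mult summable_geometric) simp
  have S: "S \<ge> 0"
    unfolding S_def using summ v by (intro suminf_nonneg) auto
  \<comment> \<open>Adding 1 keeps the constant positive even when \<open>A\<close> is 0.\<close>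
  define C where "C = \<bar>A\<bar> * S + 1"
  have "ennreal (norm (convol (k t) f x)) \<le> ennreal C * maximal_function f x"
    if f: "locally_integrable f" and t: "t > 0" for f x t
  proof -
    let ?r = "\<rho> t" and ?M = "maximal_function f x"
    define a where "a j = ?r powr \<alpha> / (2 ^ j * ?r / 2) powr (d + \<alpha>)" for j :: nat
    have r: "?r > 0" using \<rho> t .
    have "ennreal (norm (convol (k t) f x)) \<le> (\<integral>\<^sup>+y. ennreal (norm (k t (x - y) *\<^sub>R f y)) \<partial>lebesgue)"
    \<comment> \<open>Without integrability \<open>convol\<close> has the default value 0 and the
      bound is trivial.\<close>
    proof (cases "integrable lebesgue (\<lambda>y. k t (x - y) *\<^sub>R f y)")
      case True
      then show ?thesis unfolding convol_def by (rule integral_norm_bound_ennreal)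
    qed (simp add: convol_def not_integrable_integral_eq)
    also have "\<dots> \<le> (\<integral>\<^sup>+y. ennreal \<bar>A\<bar> *
        (\<Sum>j. ennreal (a j) * (ennreal (norm (f y)) * indicator (ball x (2 ^ j * ?r)) y)) \<partial>lebesgue)"
    proof (rule nn_integral_mono)
      fix y
      let ?k = "?r powr \<alpha> / (?r\<^sup>2 + (norm (x - y))\<^sup>2) powr ((d + \<alpha>) / 2)"
      have "\<bar>k t (x - y)\<bar> \<le> A * ?k"
        using k[OF t, of "x - y"] by (simp add: d_def)
      also have "\<dots> \<le> \<bar>A\<bar> * ?k"
        by (intro mult_right_mono) auto
      finally have "norm (k t (x - y) *\<^sub>R f y) \<le> \<bar>A\<bar> * ?k * norm (f y)"
        unfolding norm_scaleR by (rule mult_right_mono) simp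
      then have "ennreal (norm (k t (x - y) *\<^sub>R f y)) \<le> ennreal \<bar>A\<bar> * (ennreal ?k * ennreal (norm (f y)))"
        by (simp add: ennreal_leI mult.assoc flip: ennreal_mult)
      also have "\<dots> \<le> ennreal \<bar>A\<bar> * ((\<Sum>j. ennreal (a j) * (if norm (x - y) < 2 ^ j * ?r then 1 else 0))
          * ennreal (norm (f y)))"
        unfolding a_def using r \<alpha> d
        by (intro mult_left_mono mult_right_mono kernel_le_dyadic_sum) auto
      also have "(\<Sum>j. ennreal (a j) * (if norm (x - y) < 2 ^ j * ?r then 1 else 0)) * ennreal (norm (f y))
          = (\<Sum>j. ennreal (a j) * (ennreal (norm (f y)) * indicator (ball x (2 ^ j * ?r)) y))"
        by (subst ennreal_suminf_multc[symmetric], rule suminf_cong)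
          (auto simp: dist_norm ac_simps split: split_indicator)
      finally show "ennreal (norm (k t (x - y) *\<^sub>R f y)) \<le> ennreal \<bar>A\<bar> *
        (\<Sum>j. ennreal (a j) * (ennreal (norm (f y)) * indicator (ball x (2 ^ j * ?r)) y))" .
    qed
    also have "\<dots> = ennreal \<bar>A\<bar> *
        (\<Sum>j. ennreal (a j) * (\<integral>\<^sup>+y\<in>ball x (2 ^ j * ?r). ennreal (norm (f y)) \<partial>lebesgue))"
      using locally_integrable_measurable_ball[OF f]
      by (simp add: nn_integral_cmult nn_integral_suminf borel_measurable_times_ennreal)
    also have "\<dots> \<le> ennreal \<bar>A\<bar> * (\<Sum>j. ennreal (v * 2 powr (d + \<alpha>) * (2 powr (-\<alpha>)) ^ j) * ?M)"
    proof (intro mult_left_mono suminf_le)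
      fix j
      have "ennreal (a j) * (\<integral>\<^sup>+y\<in>ball x (2 ^ j * ?r). ennreal (norm (f y)) \<partial>lebesgue)
          \<le> ennreal (a j) * (ennreal (v * (2 ^ j * ?r) ^ CARD('n)) * ?M)"
        unfolding v_def d_def using r
        by (intro mult_left_mono integral_ball_le_maximal_function) auto
      also have "\<dots> = ennreal (a j * (v * (2 ^ j * ?r) ^ CARD('n))) * ?M"
        using v r by (subst ennreal_mult) (simp_all add: a_def mult.assoc)
      \<comment> \<open>The volume cancels the power \<open>d\<close> of the radius, and the
        remaining power \<alpha> cancels against \<open>?r powr \<alpha>\<close>, leaving a
        geometric sequence.\<close>
      also have "a j * (v * (2 ^ j * ?r) ^ CARD('n)) = v * 2 powr (d + \<alpha>) * (2 powr (-\<alpha>)) ^ j"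
      proof -
        have "(2 ^ j * ?r) ^ CARD('n) = (2 ^ j * ?r) powr d"
          using r by (simp add: powr_realpow d_def)
        also have "\<dots> = (2 powr d) ^ j * ?r powr d"
          using r by (simp add: powr_mult powr_powr flip: powr_realpow) (simp add: mult.commute)
        finally have 1: "(2 ^ j * ?r) ^ CARD('n) = (2 powr d) ^ j * ?r powr d" .
        have 2: "(2 ^ j * ?r / 2) powr (d + \<alpha>)
            = (2 powr d) ^ j * (2 powr \<alpha>) ^ j * (?r powr d * ?r powr \<alpha>) / 2 powr (d + \<alpha>)"
          using r by (simp add: powr_mult powr_divide powr_powr powr_add algebra_simps flip: powr_realpow)
        show ?thesis
          unfolding a_def 1 2 using r by (simp add: powr_minus power_inverse field_simps)
      qed
      finally show "ennreal (a j) * (\<integral>\<^sup>+y\<in>ball x (2 ^ j * ?r). ennreal (norm (f y)) \<partial>lebesgue)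
        \<le> ennreal (v * 2 powr (d + \<alpha>) * (2 powr (-\<alpha>)) ^ j) * ?M" .
    qed auto
    also have "\<dots> = ennreal (\<bar>A\<bar> * S) * ?M"
    proof -
      have "(\<Sum>j. ennreal (v * 2 powr (d + \<alpha>) * (2 powr (-\<alpha>)) ^ j)) = ennreal S"
        unfolding S_def using summ v by (intro suminf_ennreal2) auto
      then show ?thesis
        using S by (simp only: ennreal_suminf_multc) (simp add: ennreal_mult mult.assoc)
    qed
    also have "\<dots> \<le> ennreal C * ?M"
      by (intro mult_right_mono ennreal_leI) (auto simp: C_def)
    finally show ?thesis .
  qed
  moreover have "C > 0" using S by (simp add: C_def add_nonneg_pos)
  ultimately show ?thesis by blast
qed

section \<open>The three kernel families\<close>

text \<open>Exponential decay beats any power, so at length scale \<open>sqrt t\<close> the Gaussian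
  lies below a multiple of the Poisson profile.\<close>

lemma gauss_kernel_le:
  fixes z :: "real ^ 'n"
  defines "p \<equiv> (real CARD('n) + 1) / 2"
  assumes t: "t > 0"
  shows "\<bar>gauss_kernel t z\<bar> \<le> ((4 * pi) powr (- (real CARD('n) / 2)) * ((4 * p) powr p * exp (1 / 4)))
    * (sqrt t powr 1 / ((sqrt t)\<^sup>2 + (norm z)\<^sup>2) powr ((real CARD('n) + 1) / 2))"
proof -
  define w where "w = (norm z)\<^sup>2 / t"
  have p: "p > 0" by (simp add: p_def add_nonneg_pos)
  have w: "w \<ge> 0" using t by (simp add: w_def)
  \<comment> \<open>Dividing by \<open>4 * p\<close> makes the p-th power of the right side
    \<open>exp ((1 + w) / 4)\<close>, which matches the Gaussian factor
    \<open>exp (- (w / 4))\<close>.\<close>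
  have "(1 + w) / (4 * p) \<le> exp ((1 + w) / (4 * p))"
    using exp_ge_add_one_self[of "(1 + w) / (4 * p)"] by linarith
  then have "((1 + w) / (4 * p)) powr p \<le> exp ((1 + w) / (4 * p)) powr p"
    using w p by (intro powr_mono2) auto
  also have "\<dots> = exp (1 / 4) * exp (w / 4)"
    using p by (simp add: powr_def field_simps flip: exp_add)
  finally have "exp (- (w / 4)) * (1 + w) powr p \<le> (4 * p) powr p * exp (1 / 4)"
    using w p by (simp add: powr_divide exp_minus field_simps)
  moreover have "(t + (norm z)\<^sup>2) powr p = t powr p * (1 + w) powr p"
    using t w by (subst powr_mult[symmetric]) (simp_all add: w_def distrib_left)
  ultimately have "exp (- (w / 4)) \<le> (4 * p) powr p * exp (1 / 4) * (t powr p / (t + (norm z)\<^sup>2) powr p)"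
    using t w by (simp add: field_simps)
  then have "(4 * pi * t) powr (- (real CARD('n) / 2)) * exp (- (w / 4))
      \<le> (4 * pi * t) powr (- (real CARD('n) / 2)) *
        ((4 * p) powr p * exp (1 / 4) * (t powr p / (t + (norm z)\<^sup>2) powr p))"
    by (rule mult_left_mono) simp
  also have "\<dots> = ((4 * pi) powr (- (real CARD('n) / 2)) * ((4 * p) powr p * exp (1 / 4)))
      * (t powr (- (real CARD('n) / 2)) * t powr p / (t + (norm z)\<^sup>2) powr p)"
    using t by (simp add: powr_mult)
  also have "t powr (- (real CARD('n) / 2)) * t powr p = sqrt t"
    using t by (simp add: p_def powr_half_sqrt[symmetric] field_simps flip: powr_add)
  finally show ?thesis
    using t by (simp add: gauss_kernel_def p_def w_def mult.commute)
qed

text \<open>The first two kernels are constant multiples of the required profile, so of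
  \<open>normalizing_const\<close> only its being a constant enters.\<close>

lemma kernel_le_maximal_function:
  fixes K :: "real \<Rightarrow> real ^ 'n \<Rightarrow> real"
  assumes "K = poisson_kernel \<or>
           (\<exists>s. 0 < s \<and> s < 1 \<and> K = caffarelli_silvestre_kernel s) \<or>
           K = gauss_kernel"
  shows "\<exists>C>0. \<forall>f x t. locally_integrable f \<longrightarrow> t > 0 \<longrightarrow>
    ennreal (norm (convol (K t) f x)) \<le> ennreal C * maximal_function f x"
  using assms
proof (elim disjE exE conjE)
  assume K: "K = poisson_kernel"
  show ?thesis
    unfolding K poisson_kernel_def Let_def
    by (rule convol_le_maximal_function[where \<alpha> = 1 and \<rho> = "\<lambda>t. t"])
      (auto simp: abs_mult intro: eq_refl)
next
  fix s :: real
  assume s: "0 < s" and K: "K = caffarelli_silvestre_kernel s"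
  show ?thesis
    unfolding K caffarelli_silvestre_kernel_def Let_def
    by (rule convol_le_maximal_function[where \<alpha> = "2 * s" and \<rho> = "\<lambda>t. t"])
      (use s in \<open>auto simp: abs_mult intro: eq_refl\<close>)
next
  assume K: "K = gauss_kernel"
  show ?thesis
    unfolding K
    by (rule convol_le_maximal_function[where \<alpha> = 1 and \<rho> = sqrt])
      (simp, simp, rule gauss_kernel_le)
qed

section \<open>Limits and two-sided bound for the three families\<close>

theorem corollary1p6:
  fixes K :: "real \<Rightarrow> real ^ 'n \<Rightarrow> real"
  assumes "K = poisson_kernel \<or>
           (\<exists>s. 0 < s \<and> s < 1 \<and> K = caffarelli_silvestre_kernel s) \<or>
           K = gauss_kernel"
  shows "\<exists>C :: real. C > 0 \<and>
    (\<forall>(f :: real ^ 'n \<Rightarrow> complex) (x :: real ^ 'n).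
       locally_integrable f \<longrightarrow>
       lebesgue_point f x \<longrightarrow>
       (\<forall>t>0. convol_exists (K t) f x) \<longrightarrow>
       ((\<lambda>t. convol (K t) f x) \<longlongrightarrow> f x) (at_right 0) \<longrightarrow>
       bdd_above ((\<lambda>t. norm (convol (K t) f x)) ` {0<..}) \<longrightarrow>
       (\<forall>(\<gamma> :: real) (q :: real). \<gamma> \<noteq> 0 \<longrightarrow> q > 0 \<longrightarrow>
          (\<gamma> > 0 \<longrightarrow>
             (\<exists>L. (weak_quantity \<gamma> q (\<lambda>t. convol (K t) f x) \<longlongrightarrow> L) at_top \<and>
                  ennreal (norm (f x)) = ennreal (\<gamma> powr (1 / q)) * L)) \<and>
          (\<gamma> < 0 \<longrightarrow>
             (\<exists>L. (weak_quantity \<gamma> q (\<lambda>t. convol (K t) f x) \<longlongrightarrow> L) (at_right 0) \<and>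
                  ennreal (norm (f x)) = ennreal ((- \<gamma>) powr (1 / q)) * L)) \<and>
          ennreal (norm (f x)) \<le>
            ennreal (\<bar>\<gamma>\<bar> powr (1 / q)) *
              (SUP l\<in>{0<..}. weak_quantity \<gamma> q (\<lambda>t. convol (K t) f x) l) \<and>
          ennreal (\<bar>\<gamma>\<bar> powr (1 / q)) *
              (SUP l\<in>{0<..}. weak_quantity \<gamma> q (\<lambda>t. convol (K t) f x) l)
            \<le> ennreal C * maximal_function f x))"
proof -
  obtain C where "C > 0" and
    C: "locally_integrable f \<Longrightarrow> t > 0 \<Longrightarrow>
      ennreal (norm (convol (K t) f x)) \<le> ennreal C * maximal_function f x" for f x t
    using kernel_le_maximal_function[OF assms] by blast
  have SUP_le: "ennreal (\<bar>\<gamma>\<bar> powr (1 / q)) * (SUP l\<in>{0<..}. weak_quantity \<gamma> q (\<lambda>t. convol (K t) f x) l)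
      \<le> ennreal C * maximal_function f x"
    if f: "locally_integrable f" and u: "bounded_orbit (\<lambda>t. convol (K t) f x) (f x) \<gamma> q" for f x \<gamma> q
  \<comment> \<open>An infinite right-hand side is trivial; a finite one is a real bound for the
    orbit, to which \<open>weak_quantity_le\<close> applies.\<close>
  proof (cases "ennreal C * maximal_function f x")
    case (real B)
    have "norm (convol (K t) f x) \<le> B" if "t > 0" for t
      using C[OF f that, of x] real by simp
    then show ?thesis
      using bounded_orbit.weak_quantity_le[OF u] real
      by (simp add: SUP_mult_left_ennreal SUP_le_iff)
  qed simp
  show ?thesis
  proof (intro exI[of _ C] conjI allI impI SUP_le \<open>C > 0\<close>)
    fix f :: "real ^ 'n \<Rightarrow> complex" and x :: "real ^ 'n" and \<gamma> q :: real
    let ?u = "\<lambda>t. convol (K t) f x"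
    assume "(?u \<longlongrightarrow> f x) (at_right 0)" "bdd_above ((\<lambda>t. norm (?u t)) ` {0<..})" "\<gamma> \<noteq> 0" "q > 0"
    then interpret bounded_orbit ?u "f x" \<gamma> q
      by unfold_locales
    \<comment> \<open>This goal is the premise left over from applying \<open>SUP_le\<close> as an
      introduction rule.\<close>
    show "bounded_orbit ?u (f x) \<gamma> q"
      by (rule bounded_orbit_axioms)
    show "ennreal (norm (f x)) \<le>
        ennreal (\<bar>\<gamma>\<bar> powr (1 / q)) * (SUP l\<in>{0<..}. weak_quantity \<gamma> q ?u l)"
      by (rule norm_le_SUP)
    show "\<exists>L. (weak_quantity \<gamma> q ?u \<longlongrightarrow> L) at_top \<and>
        ennreal (norm (f x)) = ennreal (\<gamma> powr (1 / q)) * L" if "\<gamma> > 0"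
      using weak_quantity_tendsto norm_eq that by (auto simp: F_def)
    show "\<exists>L. (weak_quantity \<gamma> q ?u \<longlongrightarrow> L) (at_right 0) \<and>
        ennreal (norm (f x)) = ennreal ((- \<gamma>) powr (1 / q)) * L" if "\<gamma> < 0"
      using weak_quantity_tendsto norm_eq that by (auto simp: F_def)
  qed
qed

end
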